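(* For every integer $\ell\ge 3$, there exists an obtuse lattice triangle of lattice perimeter $\ell$ whose orthocenter is a lattice point, and there exists a right lattice triangle of lattice perimeter $\ell$ whose orthocenter is a lattice point.
   Context: A lattice point is an element of $\mathbb Z^2\subseteq\mathbb R^2$. A lattice triangle is a (nondegenerate) triangle in $\mathbb R^2$ whose three vertices are lattice points. The lattice length of a segment joining two lattice points is the number of lattice points on the segment (endpoints included) minus one. The lattice perimeter of a lattice triangle is the sum of the lattice lengths of its three sides. A triangle is obtuse (respectively right) if one of its interior angles is strictly greater than (respectively equal to) $\pi/2$. *)

theory Defs
  imports "HOL-Analysis.Analysis"
begin

definition lattice_point :: "real ^ 2 \<Rightarrow> bool" where
  "lattice_point p \<longleftrightarrow> (\<forall>i. p $ i \<in> \<int>)"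

text \<open>A triangle is given by its three vertices; collinearity covers coinciding vertices.\<close>

definition lattice_triangle :: "real ^ 2 \<Rightarrow> real ^ 2 \<Rightarrow> real ^ 2 \<Rightarrow> bool" where
  "lattice_triangle a b c \<longleftrightarrow>
     lattice_point a \<and> lattice_point b \<and> lattice_point c \<and> \<not> collinear {a, b, c}"

definition lattice_length :: "real ^ 2 \<Rightarrow> real ^ 2 \<Rightarrow> int" where
  "lattice_length a b = int (card {p \<in> closed_segment a b. lattice_point p}) - 1"

definition lattice_perimeter :: "real ^ 2 \<Rightarrow> real ^ 2 \<Rightarrow> real ^ 2 \<Rightarrow> int" where
  "lattice_perimeter a b c = lattice_length a b + lattice_length b c + lattice_length c a"

text \<open>The interior angle at the second argument, in radians.\<close>

definition interior_angle :: "real ^ 2 \<Rightarrow> real ^ 2 \<Rightarrow> real ^ 2 \<Rightarrow> real" where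
  "interior_angle a b c = arccos (((a - b) \<bullet> (c - b)) / (norm (a - b) * norm (c - b)))"

definition obtuse_triangle :: "real ^ 2 \<Rightarrow> real ^ 2 \<Rightarrow> real ^ 2 \<Rightarrow> bool" where
  "obtuse_triangle a b c \<longleftrightarrow>
     interior_angle c a b > pi / 2 \<or> interior_angle a b c > pi / 2 \<or> interior_angle b c a > pi / 2"

definition right_triangle :: "real ^ 2 \<Rightarrow> real ^ 2 \<Rightarrow> real ^ 2 \<Rightarrow> bool" where
  "right_triangle a b c \<longleftrightarrow>
     interior_angle c a b = pi / 2 \<or> interior_angle a b c = pi / 2 \<or> interior_angle b c a = pi / 2"

text \<open>The full line through the first argument perpendicular to the line through the other two
  (not just the segment: the orthocenter of an obtuse triangle lies outside it).\<close>

definition altitude :: "real ^ 2 \<Rightarrow> real ^ 2 \<Rightarrow> real ^ 2 \<Rightarrow> (real ^ 2) set" where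
  "altitude a b c = {p. orthogonal (p - a) (c - b)}"

text \<open>The common point of the three altitudes, which is unique when the vertices are not
  collinear.\<close>

definition is_orthocenter :: "real ^ 2 \<Rightarrow> real ^ 2 \<Rightarrow> real ^ 2 \<Rightarrow> real ^ 2 \<Rightarrow> bool" where
  "is_orthocenter h a b c \<longleftrightarrow> h \<in> altitude a b c \<inter> altitude b c a \<inter> altitude c a b"

end

theory Submission
  imports Defs
begin

text \<open>With \<open>m = l - 2\<close>, the triangle with vertices \<open>(0, 1)\<close>, \<open>(k, 0)\<close>, \<open>(k + m, 0)\<close> has
  lattice side lengths \<open>1, m, 1\<close>, because its height is \<open>1\<close>. For the same reason its
  orthocenter \<open>(0, - k (k + m))\<close> is integral. The angle at \<open>(k, 0)\<close> is right for \<open>k = 0\<close> and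
  obtuse for \<open>k = 1\<close>.\<close>

lemma lattice_point_vector_2:
  "lattice_point (vector [x, y]) \<longleftrightarrow> x \<in> \<int> \<and> y \<in> \<int>"
  by (simp add: lattice_point_def forall_2)

lemma lattice_length_commute: "lattice_length a b = lattice_length b a"
  by (simp add: lattice_length_def closed_segment_commute)

lemma lattice_length_unit_height:
  fixes j k :: int
  shows "lattice_length (vector [of_int j, 1]) (vector [of_int k, 0]) = 1"
proof -
  let ?a = "vector [of_int j, 1] :: real ^ 2" and ?b = "vector [of_int k, 0] :: real ^ 2"
  have "p = ?a \<or> p = ?b" if p: "p \<in> closed_segment ?a ?b" "lattice_point p" for p
  proof -
    obtain u where u: "0 \<le> u" "u \<le> 1" "p = (1 - u) *\<^sub>R ?a + u *\<^sub>R ?b"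
      using p(1) by (auto simp: in_segment)
    \<comment> \<open>This is the second coordinate of \<open>p\<close>, since the heights of the
      endpoints are 1 and 0.\<close>
    have "1 - u \<in> \<int>"
      using p(2) u(3) by (auto simp: lattice_point_def forall_2)
    then obtain n where "1 - u = of_int n"
      by (rule Ints_cases)
    moreover from this u(1,2) have "n = 0 \<or> n = 1"
      by linarith
    ultimately have "u = 0 \<or> u = 1" by auto
    with u(3) show ?thesis by auto
  qed
  then have "{p \<in> closed_segment ?a ?b. lattice_point p} = {?a, ?b}"
    by (auto simp: lattice_point_vector_2)
  \<comment> \<open>Distinct endpoints make the cardinality exactly 2, so the length is 2 -
    1.\<close>
  moreover have "?a \<noteq> ?b"
    by (simp add: vec_eq_iff forall_2)
  ultimately show ?thesis
    by (simp add: lattice_length_def)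
qed

text \<open>The convex parameter drops out of the second coordinate, which leaves a one-dimensional
  segment; the order of \<open>x\<close> and \<open>x'\<close> makes it an interval.\<close>

lemma closed_segment_horizontal:
  fixes p :: "real ^ 2"
  assumes "x \<le> x'"
  shows "p \<in> closed_segment (vector [x, y]) (vector [x', y]) \<longleftrightarrow> x \<le> p $ 1 \<and> p $ 1 \<le> x' \<and> p $ 2 = y"
proof -
  have "p \<in> closed_segment (vector [x, y]) (vector [x', y]) \<longleftrightarrow>
    p $ 1 \<in> closed_segment x x' \<and> p $ 2 = y"
    by (auto simp: in_segment vec_eq_iff forall_2 algebra_simps)
  with assms show ?thesis
    by (auto simp: closed_segment_eq_real_ivl)
qed

text \<open>The lattice points correspond to the k - j + 1 integers in \<open>{j..k}\<close>, and
  the length counts one less.\<close>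

lemma lattice_length_horizontal:
  fixes j k n :: int
  assumes "j \<le> k"
  shows "lattice_length (vector [of_int j, of_int n]) (vector [of_int k, of_int n]) = k - j"
proof -
  let ?f = "\<lambda>i. vector [of_int i, of_int n] :: real ^ 2"
  have "{p \<in> closed_segment (?f j) (?f k). lattice_point p} = ?f ` {j..k}"
  proof (intro equalityI subsetI)
    fix p assume "p \<in> {p \<in> closed_segment (?f j) (?f k). lattice_point p}"
    then have p: "p \<in> closed_segment (?f j) (?f k)" "p $ 1 \<in> \<int>"
      by (auto simp: lattice_point_def)
    from p(2) obtain i where i: "p $ 1 = of_int i"
      by (auto elim: Ints_cases)
    with p(1) assms have "i \<in> {j..k}" "p = ?f i"
      by (auto simp: closed_segment_horizontal vec_eq_iff forall_2)
    then show "p \<in> ?f ` {j..k}" by blast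
  qed (use assms in \<open>auto simp: closed_segment_horizontal lattice_point_vector_2\<close>)
  moreover have "inj_on ?f {j..k}"
    by (auto simp: inj_on_def vec_eq_iff forall_2)
  ultimately show ?thesis
    using assms by (simp add: lattice_length_def card_image)
qed

lemma lattice_triangle_unit_height:
  fixes k m :: int
  assumes "m > 0"
  shows "lattice_triangle (vector [0, 1]) (vector [of_int k, 0]) (vector [of_int (k + m), 0])"
proof -
  let ?a = "vector [0, 1] :: real ^ 2"
  let ?b = "vector [of_int k, 0] :: real ^ 2"
  let ?c = "vector [of_int (k + m), 0] :: real ^ 2"
  have "\<not> collinear {?a, ?b, ?c}"
  proof
    assume "collinear {?a, ?b, ?c}"
    then obtain u where u: "\<And>x y. x \<in> {?a, ?b, ?c} \<Longrightarrow> y \<in> {?a, ?b, ?c} \<Longrightarrow> \<exists>d. x - y = d *\<^sub>R u"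
      unfolding collinear_def by metis
    obtain d e where "?a - ?b = d *\<^sub>R u" "?c - ?b = e *\<^sub>R u"
      using u[of ?a ?b] u[of ?c ?b] by auto
    \<comment> \<open>The first equation gives \<open>u $ 2 \<noteq> 0\<close>, so the second forces
      e = 0, against the third with m > 0.\<close>
    then have "d * u $ 2 = 1" "e * u $ 2 = 0" "e * u $ 1 = of_int m"
      by (auto simp: vec_eq_iff forall_2)
    with assms show False by auto
  qed
  then show ?thesis
    by (auto simp: lattice_triangle_def lattice_point_vector_2)
qed

lemma lattice_perimeter_unit_height:
  fixes k m :: int
  assumes "m \<ge> 0"
  shows "lattice_perimeter (vector [0, 1]) (vector [of_int k, 0]) (vector [of_int (k + m), 0]) = m + 2"
proof -
  \<comment> \<open>The perimeter traverses this side from the base to the apex, opposite to the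
    orientation in \<open>lattice_length_unit_height\<close>.\<close>
  have "lattice_length (vector [of_int (k + m), 0]) (vector [0, 1]) = 1"
    using lattice_length_unit_height[of 0 "k + m"] by (simp add: lattice_length_commute)
  then show ?thesis
    using lattice_length_unit_height[of 0 k] lattice_length_horizontal[of k "k + m" 0] assms
    by (simp add: lattice_perimeter_def)
qed

text \<open>For x \<noteq> z the altitude from the apex is the vertical axis. On it, orthogonality
  of (-x, t) to (-z, 1) gives x z + t = 0, hence the height t = - x z; this is symmetric in x and z,
  so the third altitude passes through the same point.\<close>

lemma is_orthocenter_unit_height:
  fixes x z :: real
  shows "is_orthocenter (vector [0, - (x * z)]) (vector [0, 1]) (vector [x, 0]) (vector [z, 0])"
  by (simp add: is_orthocenter_def altitude_def orthogonal_def inner_vec_def sum_2 algebra_simps)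

lemma interior_angle_eq_pi_half:
  assumes "(a - b) \<bullet> (c - b) = 0"
  shows "interior_angle a b c = pi / 2"
  using assms by (simp add: interior_angle_def)

text \<open>The function \<open>arccos\<close> is strictly decreasing on [-1, 1] with value pi / 2
  at 0, and Cauchy-Schwarz keeps the quotient in that domain.\<close>

lemma interior_angle_gt_pi_half:
  assumes "(a - b) \<bullet> (c - b) < 0"
  shows "interior_angle a b c > pi / 2"
proof -
  \<comment> \<open>A zero vector would make the inner product 0.\<close>
  have nz: "norm (a - b) * norm (c - b) > 0"
    using assms by (auto simp: zero_less_mult_iff)
  let ?q = "((a - b) \<bullet> (c - b)) / (norm (a - b) * norm (c - b))"
  have "?q < 0"
    using assms nz by (simp add: divide_neg_pos)
  moreover have "- 1 \<le> ?q"
    using Cauchy_Schwarz_ineq2[of "a - b" "c - b"] nz by (simp add: field_simps abs_le_iff)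
  ultimately have "arccos 0 < arccos ?q"
    by (intro arccos_less_arccos) auto
  then show ?thesis
    by (simp add: interior_angle_def)
qed

theorem mainTheorem4:
  fixes l :: int
  assumes "l \<ge> 3"
  shows "(\<exists>a b c h. lattice_triangle a b c \<and> obtuse_triangle a b c \<and>
            lattice_perimeter a b c = l \<and> is_orthocenter h a b c \<and> lattice_point h) \<and>
         (\<exists>a b c h. lattice_triangle a b c \<and> right_triangle a b c \<and>
            lattice_perimeter a b c = l \<and> is_orthocenter h a b c \<and> lattice_point h)"
proof -
  define a :: "real ^ 2" where "a = vector [0, 1]"
  define b :: "int \<Rightarrow> real ^ 2" where "b k = vector [of_int k, 0]" for k
  define c :: "int \<Rightarrow> real ^ 2" where "c k = vector [of_int (k + (l - 2)), 0]" for k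
  define h :: "int \<Rightarrow> real ^ 2" where "h k = vector [0, - (of_int k * of_int (k + (l - 2)))]" for k
  have common: "lattice_triangle a (b k) (c k)" "lattice_perimeter a (b k) (c k) = l"
    "is_orthocenter (h k) a (b k) (c k)" "lattice_point (h k)" for k
    using assms lattice_triangle_unit_height[of "l - 2" k] lattice_perimeter_unit_height[of "l - 2" k]
      is_orthocenter_unit_height[of "of_int k" "of_int (k + (l - 2))"]
    by (simp_all add: a_def b_def c_def h_def lattice_point_vector_2)
  \<comment> \<open>This is (-k, 1) \<bullet> (l - 2, 0). As l - 2 > 0, the sign of k alone decides
    the type of the angle at \<open>b k\<close>.\<close>
  have inner: "(a - b k) \<bullet> (c k - b k) = - of_int (k * (l - 2))" for k
    by (simp add: a_def b_def c_def inner_vec_def sum_2)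
  have "obtuse_triangle a (b 1) (c 1)"
    using interior_angle_gt_pi_half[of a "b 1" "c 1"] inner[of 1] assms
    by (simp add: obtuse_triangle_def)
  moreover have "right_triangle a (b 0) (c 0)"
    using interior_angle_eq_pi_half[of a "b 0" "c 0"] inner[of 0]
    by (simp add: right_triangle_def)
  ultimately show ?thesis
    using common by blast
qed

end
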